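(* Let $h(\eta)=c_1\eta^{-c_2}$ ($\eta>0$) with constants $c_1,c_2>0$. Then $$h^{-1}(b)=\left(\frac{c_1}{b}\right)^{1/c_2}\quad\text{and}\quad \nabla_bh^{-1}(b)=-\frac{c_1^{1/c_2}b^{-(1+c_2)/c_2}}{c_2}.$$ Furthermore, let $K\ge1$, $L,R,A_K>0$ and $u_0,\dots,u_{K-1}>0$ be fixed. The optimal primal solution and the optimal dual multiplier $\lambda^*$ of the inequality constraint of $$\min_{\mathbf{b}\ge\mathbf{0}}\ \sum_{k=0}^{K-1}h^{-1}(b_k)\quad\text{s.t.}\quad\sum_{k=0}^{K-1}u_kb_k^2\le\frac{LR^2}{4A_K}$$ are $$b_k^*=\frac{\sqrt{L}\,R}{2\sqrt{A_K\sum_{j=0}^{K-1}u_j^{1/(1+2c_2)}}\;u_k^{c_2/(1+2c_2)}},\quad k=0,\dots,K-1,$$ $$\lambda^*=\frac{c_1^{1/c_2}}{2c_2}\left(\frac{LR^2}{4A_K}\right)^{-(1+2c_2)/(2c_2)}\left(\sum_{k=0}^{K-1}u_k^{1/(1+2c_2)}\right)^{(1+2c_2)/(2c_2)}.$$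
   Context: The Lagrangian of the problem is $\mathcal{L}(\mathbf{b},\lambda)=\sum_{k=0}^{K-1}h^{-1}(b_k)+\lambda\left(\sum_{k=0}^{K-1}u_kb_k^2-\frac{LR^2}{4A_K}\right)$. The weights $u_k$ are treated as fixed positive numbers independent of $\mathbf{b}$. The objective is regarded as $+\infty$ if some $b_k=0$. *)

theory Defs
  imports "HOL-Analysis.Analysis" "HOL-Library.Extended_Real"
begin

text \<open>
  Vectors in \<open>K\<close>-dimensional space are functions on \<open>nat\<close>; only their values at \<open>k < K\<close> matter in the
  definitions below.  \<open>g\<close> is the cost of a single coordinate and \<open>B\<close> the right-hand side of the
  quadratic constraint.
\<close>

definition nonneg_vec :: "nat \<Rightarrow> (nat \<Rightarrow> real) \<Rightarrow> bool" where
  "nonneg_vec K b \<longleftrightarrow> (\<forall>k<K. 0 \<le> b k)"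

definition objective :: "(real \<Rightarrow> real) \<Rightarrow> nat \<Rightarrow> (nat \<Rightarrow> real) \<Rightarrow> ereal" where
  "objective g K b = (if \<exists>k<K. b k = 0 then \<infinity> else ereal (\<Sum>k<K. g (b k)))"

definition feasible :: "nat \<Rightarrow> (nat \<Rightarrow> real) \<Rightarrow> real \<Rightarrow> (nat \<Rightarrow> real) \<Rightarrow> bool" where
  "feasible K u B b \<longleftrightarrow> nonneg_vec K b \<and> (\<Sum>k<K. u k * (b k)\<^sup>2) \<le> B"

definition primal_optimal ::
    "(real \<Rightarrow> real) \<Rightarrow> nat \<Rightarrow> (nat \<Rightarrow> real) \<Rightarrow> real \<Rightarrow> (nat \<Rightarrow> real) \<Rightarrow> bool" where
  "primal_optimal g K u B b \<longleftrightarrow>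
     feasible K u B b \<and> (\<forall>b'. feasible K u B b' \<longrightarrow> objective g K b \<le> objective g K b')"

definition lagrangian ::
    "(real \<Rightarrow> real) \<Rightarrow> nat \<Rightarrow> (nat \<Rightarrow> real) \<Rightarrow> real \<Rightarrow> (nat \<Rightarrow> real) \<Rightarrow> real \<Rightarrow> ereal" where
  "lagrangian g K u B b lam = objective g K b + ereal (lam * ((\<Sum>k<K. u k * (b k)\<^sup>2) - B))"

text \<open>
  Only the quadratic constraint is dualised; the constraint \<open>b \<ge> 0\<close> is kept as the domain of the
  Lagrangian.
\<close>

definition dual_function ::
    "(real \<Rightarrow> real) \<Rightarrow> nat \<Rightarrow> (nat \<Rightarrow> real) \<Rightarrow> real \<Rightarrow> real \<Rightarrow> ereal" where
  "dual_function g K u B lam = (INF b\<in>{b. nonneg_vec K b}. lagrangian g K u B b lam)"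

definition dual_optimal ::
    "(real \<Rightarrow> real) \<Rightarrow> nat \<Rightarrow> (nat \<Rightarrow> real) \<Rightarrow> real \<Rightarrow> real \<Rightarrow> bool" where
  "dual_optimal g K u B lam \<longleftrightarrow>
     0 \<le> lam \<and> (\<forall>mu\<ge>0. dual_function g K u B mu \<le> dual_function g K u B lam)"

end

theory Submission
  imports Defs
begin

text \<open>
  Put \<open>p = 1 / c2\<close>, so that \<open>h\<inverse>(x) = C * x powr - p\<close>, which is strictly convex as a function of
  \<open>x\<^sup>2\<close>.  Hence a point \<open>t\<close> that satisfies the constraint with equality and the stationarity
  condition \<open>lam * u k = C * (p / 2) * t k powr (- p - 2)\<close> is the unique minimiser of the Lagrangian
  at \<open>lam\<close>, thus the unique primal solution, and \<open>lam\<close> attains the dual optimum, which equals the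
  primal value \<open>G\<close>.  If \<open>mu\<close> is dual optimal, then \<open>t\<close> also minimises the Lagrangian at \<open>mu\<close>;
  differentiating along the ray through \<open>t\<close> gives \<open>p * G = 2 * mu * B\<close>, which determines \<open>mu\<close>.
\<close>

section \<open>A tangent inequality for negative powers\<close>

text \<open>With \<open>z = x^2\<close> the function is \<open>z powr (- p / 2)\<close>, which is
  convex, and the bound is its tangent at \<open>t^2\<close>. Scaling by \<open>r = x / t\<close>
  reduces it to two elementary bounds, \<open>1 + y <= exp y\<close> at
  \<open>y = - p * ln r\<close> and \<open>ln y <= y - 1\<close> at \<open>y = r^2\<close>.\<close>

lemma powr_minus_tangent_square:
  fixes x t p :: real
  assumes "x > 0" "t > 0" "p > 0"
  shows "t powr - p - p / 2 * t powr (- p - 2) * (x\<^sup>2 - t\<^sup>2) \<le> x powr - p"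
    and "x powr - p = t powr - p - p / 2 * t powr (- p - 2) * (x\<^sup>2 - t\<^sup>2) \<Longrightarrow> x = t"
proof -
  define r where "r = x / t"
  have r: "r > 0" "x = r * t"
    using assms by (auto simp: r_def)
  have ln_le: "2 * ln r \<le> r\<^sup>2 - 1"
    using ln_le_minus_one[of "r\<^sup>2"] r by (simp add: ln_realpow)
  have "1 - p * ln r \<le> r powr - p"
    using exp_ge_add_one_self[of "- p * ln r"] r by (simp add: powr_def)
  moreover have p_ln: "p * (2 * ln r) \<le> p * (r\<^sup>2 - 1)"
    using ln_le assms by (intro mult_left_mono) auto
  ultimately have le: "1 - p / 2 * (r\<^sup>2 - 1) \<le> 1 - p * ln r" "1 - p * ln r \<le> r powr - p"
    by (auto simp: algebra_simps)
  have "t powr (- p - 2) * t\<^sup>2 = t powr - p"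
    using assms by (simp flip: powr_numeral powr_add)
  then have scale: "t powr - p - p / 2 * t powr (- p - 2) * (x\<^sup>2 - t\<^sup>2)
      = t powr - p * (1 - p / 2 * (r\<^sup>2 - 1))"
    unfolding r(2) by (simp add: algebra_simps power_mult_distrib)
  have x_powr: "x powr - p = t powr - p * r powr - p"
    using r assms by (simp add: powr_mult)
  show "t powr - p - p / 2 * t powr (- p - 2) * (x\<^sup>2 - t\<^sup>2) \<le> x powr - p"
    unfolding scale x_powr using le by (intro mult_left_mono) auto
  assume "x powr - p = t powr - p - p / 2 * t powr (- p - 2) * (x\<^sup>2 - t\<^sup>2)"
  then have "r powr - p = 1 - p / 2 * (r\<^sup>2 - 1)"
    unfolding scale x_powr using assms by simp
  \<comment> \<open>The outer terms of the chain \<open>le\<close> now agree, so its middle term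
    equals both; \<open>ln y = y - 1\<close> then forces \<open>y = 1\<close>.\<close>
  then have "p * (2 * ln r) = p * (r\<^sup>2 - 1)"
    using le by (simp add: algebra_simps)
  then have "ln (r\<^sup>2) = r\<^sup>2 - 1"
    using assms r by (simp add: ln_realpow)
  then have "r\<^sup>2 = 1"
    using r by (intro ln_eq_minus_one) auto
  then show "x = t"
    using r by (simp add: power2_eq_1_iff)
qed

lemma objective_pos:
  "(\<And>k. k < K \<Longrightarrow> b k > 0) \<Longrightarrow> objective g K b = ereal (\<Sum>k<K. g (b k))"
  unfolding objective_def by (auto simp: less_le)

text \<open>Separates the vectors with a zero coordinate, where lower bounds on the objective are
  trivial, from those on which \<open>g\<close> obeys the power law.\<close>

lemma nonneg_vec_objective_cases:
  assumes "nonneg_vec K b"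
  obtains "objective g K b = \<infinity>" | "\<And>k. k < K \<Longrightarrow> b k > 0"
  using assms unfolding nonneg_vec_def objective_def by (metis less_le)

section \<open>Optimality and uniqueness from a stationary point\<close>

text \<open>\<open>stationary\<close> says that the derivative of the Lagrangian in coordinate
  \<open>k\<close> vanishes at \<open>t k\<close>, after division by \<open>2 * t k\<close>. Keeping
  \<open>t\<close> and \<open>lam\<close> abstract separates the duality argument from the closed
  forms.\<close>

locale stationary_point =
  fixes g :: "real \<Rightarrow> real" and C p :: real
    and K :: nat and u t :: "nat \<Rightarrow> real" and B lam :: real
  assumes C: "C > 0" and p: "p > 0" and B: "B > 0" and lam: "lam > 0"
    and u: "\<And>k. k < K \<Longrightarrow> u k > 0" and t: "\<And>k. k < K \<Longrightarrow> t k > 0"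
    and g: "\<And>x. x > 0 \<Longrightarrow> g x = C * x powr - p"
    and stationary: "\<And>k. k < K \<Longrightarrow> lam * u k = C * (p / 2) * t k powr (- p - 2)"
    and tight: "(\<Sum>k<K. u k * (t k)\<^sup>2) = B"
begin

definition G where "G = (\<Sum>k<K. g (t k))"

lemma nonneg_vec_t: "nonneg_vec K t"
  using t by (simp add: nonneg_vec_def less_imp_le)

text \<open>By \<open>stationary\<close>, \<open>C\<close> times the tangent has slope
  \<open>- lam * u k\<close> in \<open>x^2\<close>, so adding the penalty
  \<open>lam * u k * x^2\<close> makes it constant.\<close>

lemma coordinate_tangent:
  assumes "k < K" "x > 0"
  shows "g (t k) + lam * (u k * (t k)\<^sup>2) \<le> g x + lam * (u k * x\<^sup>2)"
    and "g x + lam * (u k * x\<^sup>2) = g (t k) + lam * (u k * (t k)\<^sup>2) \<Longrightarrow> x = t k"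
proof -
  define y where "y = t k powr - p - p / 2 * t k powr (- p - 2) * (x\<^sup>2 - (t k)\<^sup>2)"
  have "C * y = g (t k) - lam * u k * (x\<^sup>2 - (t k)\<^sup>2)"
    unfolding stationary[OF assms(1)] y_def g[OF t[OF assms(1)]] by (simp add: algebra_simps)
  then have y: "g (t k) + lam * (u k * (t k)\<^sup>2) = C * y + lam * (u k * x\<^sup>2)"
    by (simp add: algebra_simps)
  note tangent = powr_minus_tangent_square[OF assms(2) t[OF assms(1)] p, folded y_def]
  show "g (t k) + lam * (u k * (t k)\<^sup>2) \<le> g x + lam * (u k * x\<^sup>2)"
    unfolding y using tangent(1) C assms by (simp add: g)
  show "x = t k" if "g x + lam * (u k * x\<^sup>2) = g (t k) + lam * (u k * (t k)\<^sup>2)"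
    using that tangent(2) C assms unfolding y by (simp add: g)
qed

text \<open>The Lagrangian is separable, so the coordinate bounds add up, and one strict coordinate
  makes the sum strict. Tightness turns the penalty at \<open>t\<close> into
  \<open>lam * B\<close>.\<close>

lemma
  assumes "\<And>k. k < K \<Longrightarrow> b k > 0"
  shows lagrangian_ge: "G + lam * B \<le> (\<Sum>k<K. g (b k)) + lam * (\<Sum>k<K. u k * (b k)\<^sup>2)"
    and lagrangian_le_imp_eq:
      "(\<Sum>k<K. g (b k)) + lam * (\<Sum>k<K. u k * (b k)\<^sup>2) \<le> G + lam * B \<Longrightarrow> k < K \<Longrightarrow> b k = t k"
proof -
  let ?f = "\<lambda>b k. g (b k) + lam * (u k * (b k)\<^sup>2)"
  have sums: "G + lam * B = (\<Sum>k<K. ?f t k)"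
    "(\<Sum>k<K. g (b k)) + lam * (\<Sum>k<K. u k * (b k)\<^sup>2) = (\<Sum>k<K. ?f b k)"
    unfolding G_def tight[symmetric] by (simp_all add: sum.distrib sum_distrib_left)
  have le: "?f t k \<le> ?f b k" if "k < K" for k
    using coordinate_tangent(1)[OF that assms[OF that]] .
  show "G + lam * B \<le> (\<Sum>k<K. g (b k)) + lam * (\<Sum>k<K. u k * (b k)\<^sup>2)"
    unfolding sums by (intro sum_mono le) auto
  show "b k = t k"
    if *: "(\<Sum>k<K. g (b k)) + lam * (\<Sum>k<K. u k * (b k)\<^sup>2) \<le> G + lam * B" and k: "k < K"
  proof (rule ccontr)
    assume "b k \<noteq> t k"
    then have "?f t k < ?f b k"
      using le[OF k] coordinate_tangent(2)[OF k assms[OF k]] by (auto simp: less_le)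
    then have "(\<Sum>k<K. ?f t k) < (\<Sum>k<K. ?f b k)"
      using k le by (intro sum_strict_mono_ex1) auto
    with * show False
      unfolding sums by simp
  qed
qed

lemma feasible_t: "feasible K u B t"
  by (simp add: feasible_def nonneg_vec_t tight)

lemma objective_t: "objective g K t = ereal G"
  using t by (simp add: objective_pos G_def)

lemma feasible_imp_lagrangian_le:
  "feasible K u B b \<Longrightarrow> lam * (\<Sum>k<K. u k * (b k)\<^sup>2) \<le> lam * B"
  using lam by (simp add: feasible_def)

lemma primal_optimal_t: "primal_optimal g K u B t"
  unfolding primal_optimal_def objective_t
proof (intro conjI feasible_t allI impI)
  fix b assume b: "feasible K u B b"
  then have "nonneg_vec K b"
    by (simp add: feasible_def)
  then show "ereal G \<le> objective g K b"
  proof (cases rule: nonneg_vec_objective_cases[where g = g])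
    case 2
    show ?thesis
      using lagrangian_ge[of b] 2 feasible_imp_lagrangian_le[OF b] by (simp add: objective_pos)
  qed simp
qed

text \<open>A feasible competitor with objective at most \<open>G\<close> pays a penalty of at most
  \<open>lam * B\<close>, so it also minimises the Lagrangian and must agree with
  \<open>t\<close>.\<close>

lemma primal_optimal_iff: "primal_optimal g K u B b \<longleftrightarrow> (\<forall>k<K. b k = t k)"
proof
  assume opt: "primal_optimal g K u B b"
  then have feas: "feasible K u B b" and le: "objective g K b \<le> ereal G"
    using feasible_t by (auto simp: primal_optimal_def objective_t[symmetric])
  then have "nonneg_vec K b"
    by (simp add: feasible_def)
  then show "\<forall>k<K. b k = t k"
  proof (cases rule: nonneg_vec_objective_cases[where g = g])
    case 1
    with le show ?thesis by simp
  next
    case 2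
    then have "(\<Sum>k<K. g (b k)) \<le> G"
      using le by (simp add: objective_pos)
    then have "(\<Sum>k<K. g (b k)) + lam * (\<Sum>k<K. u k * (b k)\<^sup>2) \<le> G + lam * B"
      using feasible_imp_lagrangian_le[OF feas] by (rule add_mono)
    then show ?thesis
      using lagrangian_le_imp_eq[of b] 2 by blast
  qed
next
  assume eq: "\<forall>k<K. b k = t k"
  then have "(\<Sum>k<K. u k * (b k)\<^sup>2) = (\<Sum>k<K. u k * (t k)\<^sup>2)"
      "(\<Sum>k<K. g (b k)) = (\<Sum>k<K. g (t k))"
    by simp_all
  with eq have "feasible K u B b = feasible K u B t" "objective g K b = objective g K t"
    unfolding feasible_def nonneg_vec_def objective_def by auto
  then show "primal_optimal g K u B b"
    using primal_optimal_t by (simp add: primal_optimal_def)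
qed

text \<open>The constraint has no slack at \<open>t\<close>, so the Lagrangian at \<open>t\<close>
  is \<open>G\<close> for every multiplier.\<close>

lemma dual_function_le: "dual_function g K u B mu \<le> ereal G"
proof -
  have "dual_function g K u B mu \<le> lagrangian g K u B t mu"
    unfolding dual_function_def by (intro INF_lower) (simp add: nonneg_vec_t)
  then show ?thesis
    by (simp add: lagrangian_def objective_t tight)
qed

lemma dual_function_lam: "dual_function g K u B lam = ereal G"
proof (rule antisym[OF dual_function_le])
  show "ereal G \<le> dual_function g K u B lam"
    unfolding dual_function_def
  proof (rule INF_greatest)
    fix b assume "b \<in> {b. nonneg_vec K b}"
    then have "nonneg_vec K b"
      by simp
    then show "ereal G \<le> lagrangian g K u B b lam"
    proof (cases rule: nonneg_vec_objective_cases[where g = g])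
      case 2
      then show ?thesis
        using lagrangian_ge[of b] 2 by (simp add: lagrangian_def objective_pos algebra_simps)
    qed (simp add: lagrangian_def)
  qed
qed

lemma dual_optimal_lam: "dual_optimal g K u B lam"
  using lam dual_function_le by (simp add: dual_optimal_def dual_function_lam)

lemma dual_optimal_imp_balance:
  assumes "dual_optimal g K u B mu"
  shows "p * G = 2 * mu * B"
proof -
  \<comment> \<open>The Lagrangian at \<open>mu\<close> along the ray \<open>s * t\<close>: the
    objective is homogeneous of degree \<open>- p\<close>, the constraint sum of degree 2, and
    \<open>f 1 = G\<close>.\<close>
  define f where "f s = s powr - p * G + mu * (B * (s\<^sup>2 - 1))" for s
  have "f 1 \<le> f s" if s: "s > 0" for s
  proof -
    have pos: "\<And>k. k < K \<Longrightarrow> s * t k > 0"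
      using s t by simp
    have "ereal G \<le> dual_function g K u B mu"
      using assms lam by (auto simp: dual_optimal_def dual_function_lam[symmetric])
    also have "\<dots> \<le> lagrangian g K u B (\<lambda>k. s * t k) mu"
      unfolding dual_function_def using pos
      by (intro INF_lower) (simp add: nonneg_vec_def less_imp_le)
    also have "\<dots> = ereal ((\<Sum>k<K. g (s * t k)) + mu * ((\<Sum>k<K. u k * (s * t k)\<^sup>2) - B))"
      using pos by (simp add: lagrangian_def objective_pos)
    also have "(\<Sum>k<K. g (s * t k)) = s powr - p * G"
      unfolding G_def sum_distrib_left using pos s t
      by (intro sum.cong) (auto simp: g powr_mult)
    also have "(\<Sum>k<K. u k * (s * t k)\<^sup>2) = s\<^sup>2 * B"
      unfolding tight[symmetric] sum_distrib_left
      by (intro sum.cong) (auto simp: power_mult_distrib)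
    finally show ?thesis
      by (simp add: f_def algebra_simps)
  qed
  \<comment> \<open>Radius 1 around 1 keeps \<open>s\<close> positive.\<close>
  then have min: "\<forall>s. \<bar>1 - s\<bar> < 1 \<longrightarrow> f 1 \<le> f s"
    by auto
  have "(f has_real_derivative - p * G + 2 * mu * B) (at 1)"
    unfolding f_def by (auto intro!: derivative_eq_intros)
  from DERIV_local_min[OF this _ min] show ?thesis
    by simp
qed

lemma dual_optimal_iff: "dual_optimal g K u B mu \<longleftrightarrow> mu = lam"
  \<comment> \<open>The multiplier \<open>lam\<close> satisfies the same balance equation as
    \<open>mu\<close>, and \<open>B > 0\<close> cancels.\<close>
  using dual_optimal_lam dual_optimal_imp_balance[of mu] dual_optimal_imp_balance[of lam] B by auto

end

section \<open>The inverse of the power law and its derivative\<close>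

lemma power_law_inverse:
  fixes h :: "real \<Rightarrow> real" and c1 c2 :: real
  assumes c1: "c1 > 0" and c2: "c2 > 0"
    and h: "\<And>\<eta>. \<eta> > 0 \<Longrightarrow> h \<eta> = c1 * \<eta> powr (- c2)"
  shows "bij_betw h {0<..} {0<..}"
    and "b > 0 \<Longrightarrow> inv_into {0<..} h b = (c1 / b) powr (1 / c2)"
proof -
  have right: "h ((c1 / b) powr (1 / c2)) = b" if "b > 0" for b
    using that c1 c2 by (simp add: h powr_powr powr_neg_one)
  have left: "(c1 / h x) powr (1 / c2) = x" if "x > 0" for x
    using that c1 c2 by (simp add: h powr_powr powr_minus_divide)
  show bij: "bij_betw h {0<..} {0<..}"
    by (rule bij_betw_byWitness[where f' = "\<lambda>b. (c1 / b) powr (1 / c2)"])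
      (use c1 left right in \<open>auto simp: h\<close>)
  show "inv_into {0<..} h b = (c1 / b) powr (1 / c2)" if "b > 0"
    using that c1 bij_betw_imp_inj_on[OF bij] right by (intro inv_into_f_eq) auto
qed

lemma has_real_derivative_power_law_inverse:
  fixes c1 c2 b :: real
  assumes "c1 > 0" "c2 > 0" "b > 0"
    and inv: "\<And>x. x > 0 \<Longrightarrow> f x = (c1 / x) powr (1 / c2)"
  shows "(f has_real_derivative - (c1 powr (1 / c2) * b powr (- (1 + c2) / c2) / c2)) (at b)"
proof -
  have exponent: "- (1 / c2) - 1 = - (1 + c2) / c2"
    using assms by (simp add: field_simps)
  have "((\<lambda>x. c1 powr (1 / c2) * x powr - (1 / c2)) has_real_derivative
      c1 powr (1 / c2) * (- (1 / c2) * b powr (- (1 / c2) - 1))) (at b)"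
    using assms by (intro DERIV_cmult has_real_derivative_powr)
  then have "((\<lambda>x. c1 powr (1 / c2) * x powr - (1 / c2)) has_real_derivative
      - (c1 powr (1 / c2) * b powr (- (1 + c2) / c2) / c2)) (at b)"
    unfolding exponent by simp
  then show ?thesis
    \<comment> \<open>The formula for \<open>f\<close> is known on the open half-line, a
      neighbourhood of \<open>b\<close>, which is enough for the derivative.\<close>
    by (rule has_field_derivative_transform_within_open[where S = "{0<..}"])
      (use assms in \<open>auto simp: powr_divide powr_minus_divide\<close>)
qed

section \<open>The closed forms of the optimum and the multiplier\<close>

text \<open>Stationarity makes \<open>t k\<close> proportional to
  \<open>u k powr (- 1 / (p + 2))\<close>, where \<open>1 / (p + 2) = c2 / (1 + 2 * c2)\<close> for
  \<open>p = 1 / c2\<close>. Tightness fixes the factor \<open>sqrt (B / S)\<close>, and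
  stationarity then yields the multiplier.\<close>

lemma stationary_point_power_law:
  fixes K :: nat and c1 c2 B :: real and u :: "nat \<Rightarrow> real"
  defines "S \<equiv> \<Sum>k<K. u k powr (1 / (1 + 2 * c2))"
  assumes c1: "c1 > 0" and c2: "c2 > 0" and B: "B > 0" and K: "K \<ge> 1"
    and u: "\<And>k. k < K \<Longrightarrow> u k > 0"
    and g: "\<And>x. x > 0 \<Longrightarrow> g x = (c1 / x) powr (1 / c2)"
  shows "stationary_point g (c1 powr (1 / c2)) (1 / c2) K u
      (\<lambda>k. sqrt (B / S) / u k powr (c2 / (1 + 2 * c2))) B
      (c1 powr (1 / c2) / (2 * c2) * B powr (- (1 + 2 * c2) / (2 * c2))
        * S powr ((1 + 2 * c2) / (2 * c2)))"
    (is "stationary_point g ?C ?p K u ?t B ?lam")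
proof -
  have S: "S > 0"
    unfolding S_def
  proof (rule sum_pos)
    show "u k powr (1 / (1 + 2 * c2)) > 0" if "k \<in> {..<K}" for k
      using u[of k] that by simp
  qed (use K in \<open>auto simp: lessThan_empty_iff\<close>)
  have t: "?t k = sqrt (B / S) * u k powr - (c2 / (1 + 2 * c2))" for k
    by (simp add: powr_minus_divide)
  show "stationary_point g ?C ?p K u ?t B ?lam"
  proof
    fix k assume k: "k < K"
    note uk = u[OF k]
    show "?t k > 0"
      using uk S B by simp
    \<comment> \<open>The exponents that result for the two factors of \<open>?t k\<close>: the
      square root contributes \<open>1 / 2\<close>, and \<open>u k\<close> is left with power
      1.\<close>
    have e1: "1 / 2 * (- ?p - 2) = - (1 + 2 * c2) / (2 * c2)"
      using c2 by (simp add: field_simps)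
    have e2: "- (c2 / (1 + 2 * c2)) * (- ?p - 2) = 1"
      using c2 by (simp add: divide_simps)
    have "?t k powr (- ?p - 2)
        = ((B / S) powr (1 / 2)) powr (- ?p - 2) * (u k powr - (c2 / (1 + 2 * c2))) powr (- ?p - 2)"
      unfolding t using S B by (subst powr_mult) (auto simp: powr_half_sqrt)
    also have "\<dots> = (B / S) powr (- (1 + 2 * c2) / (2 * c2)) * u k"
      unfolding powr_powr e1 e2 using uk by simp
    also have "(B / S) powr (- (1 + 2 * c2) / (2 * c2))
        = B powr (- (1 + 2 * c2) / (2 * c2)) * S powr ((1 + 2 * c2) / (2 * c2))"
      using S B unfolding minus_divide_left[symmetric] by (simp add: powr_divide powr_minus_divide)
    finally show "?lam * u k = ?C * (?p / 2) * ?t k powr (- ?p - 2)"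
      by simp
  next
    have "u k * (?t k)\<^sup>2 = B / S * u k powr (1 / (1 + 2 * c2))" if "k < K" for k
    proof -
      \<comment> \<open>Total exponent of \<open>u k\<close> in \<open>u k * (?t k)^2\<close>; it is
        the one in \<open>S\<close>, so the sum collapses to \<open>B / S * S\<close>.\<close>
      have e: "1 + (- (c2 / (1 + 2 * c2)) + - (c2 / (1 + 2 * c2))) = 1 / (1 + 2 * c2)"
        using c2 by (simp add: divide_simps)
      have "u k * (?t k)\<^sup>2 = B / S * (u k powr 1 *
          (u k powr - (c2 / (1 + 2 * c2)) * u k powr - (c2 / (1 + 2 * c2))))"
        unfolding t power_mult_distrib using S B u[OF that] by (simp add: power2_eq_square)
      also have "\<dots> = B / S * u k powr (1 / (1 + 2 * c2))"
        unfolding powr_add[symmetric] e ..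
      finally show ?thesis .
    qed
    then have "(\<Sum>k<K. u k * (?t k)\<^sup>2) = B / S * S"
      unfolding S_def sum_distrib_left by (intro sum.cong) auto
    then show "(\<Sum>k<K. u k * (?t k)\<^sup>2) = B"
      using S by simp
  qed (use c1 c2 B S u in \<open>auto simp: g powr_divide powr_minus_divide\<close>)
qed

theorem lemma1:
  fixes h :: "real \<Rightarrow> real" and c1 c2 :: real
  assumes c1: "c1 > 0" and c2: "c2 > 0"
    and h: "\<And>\<eta>. \<eta> > 0 \<Longrightarrow> h \<eta> = c1 * \<eta> powr (- c2)"
  shows "bij_betw h {0<..} {0<..}
    \<and> (\<forall>b>0. inv_into {0<..} h b = (c1 / b) powr (1 / c2))
    \<and> (\<forall>b>0. (inv_into {0<..} h has_real_derivative
          - (c1 powr (1 / c2) * b powr (- (1 + c2) / c2) / c2)) (at b))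
    \<and> (\<forall>(K::nat) (L::real) (R::real) (A::real) (u :: nat \<Rightarrow> real).
        K \<ge> 1 \<and> L > 0 \<and> R > 0 \<and> A > 0 \<and> (\<forall>k<K. u k > 0) \<longrightarrow>
          (\<forall>b. primal_optimal (inv_into {0<..} h) K u (L * R\<^sup>2 / (4 * A)) b \<longleftrightarrow>
            (\<forall>k<K. b k = sqrt L * R /
               (2 * sqrt (A * (\<Sum>j<K. u j powr (1 / (1 + 2 * c2))))
                  * u k powr (c2 / (1 + 2 * c2)))))
        \<and> (\<forall>lam. dual_optimal (inv_into {0<..} h) K u (L * R\<^sup>2 / (4 * A)) lam \<longleftrightarrow>
            lam = c1 powr (1 / c2) / (2 * c2)
              * (L * R\<^sup>2 / (4 * A)) powr (- (1 + 2 * c2) / (2 * c2))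
              * (\<Sum>k<K. u k powr (1 / (1 + 2 * c2))) powr ((1 + 2 * c2) / (2 * c2))))"
proof (intro conjI allI impI)
  show "bij_betw h {0<..} {0<..}"
    using c1 c2 h by (rule power_law_inverse)
  show inv: "inv_into {0<..} h b = (c1 / b) powr (1 / c2)" if "b > 0" for b
    using c1 c2 h that by (rule power_law_inverse)
  show "(inv_into {0<..} h has_real_derivative
      - (c1 powr (1 / c2) * b powr (- (1 + c2) / c2) / c2)) (at b)" if "b > 0" for b
    using c1 c2 that inv by (rule has_real_derivative_power_law_inverse)
  fix K :: nat and L R A :: real and u :: "nat \<Rightarrow> real"
  assume asm: "K \<ge> 1 \<and> L > 0 \<and> R > 0 \<and> A > 0 \<and> (\<forall>k<K. u k > 0)"
  define B where "B = L * R\<^sup>2 / (4 * A)"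
  define S where "S = (\<Sum>j<K. u j powr (1 / (1 + 2 * c2)))"
  have B: "B > 0" and K: "K \<ge> 1" and u: "\<And>k. k < K \<Longrightarrow> u k > 0"
    using asm by (auto simp: B_def)
  interpret stationary_point "inv_into {0<..} h" "c1 powr (1 / c2)" "1 / c2" K u
      "\<lambda>k. sqrt (B / S) / u k powr (c2 / (1 + 2 * c2))" B
      "c1 powr (1 / c2) / (2 * c2) * B powr (- (1 + 2 * c2) / (2 * c2))
        * S powr ((1 + 2 * c2) / (2 * c2))"
    unfolding S_def using c1 c2 B K u inv by (rule stationary_point_power_law)
  \<comment> \<open>Here \<open>R > 0\<close> gives \<open>sqrt (R^2) = R\<close>, and the 4 in
    \<open>B\<close> becomes the factor 2.\<close>
  have "sqrt (B / S) = sqrt L * R / (2 * sqrt (A * S))"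
    using asm by (simp add: B_def real_sqrt_divide real_sqrt_mult)
  then show "primal_optimal (inv_into {0<..} h) K u (L * R\<^sup>2 / (4 * A)) b \<longleftrightarrow>
      (\<forall>k<K. b k = sqrt L * R / (2 * sqrt (A * (\<Sum>j<K. u j powr (1 / (1 + 2 * c2))))
        * u k powr (c2 / (1 + 2 * c2))))" for b
    using primal_optimal_iff[of b] by (simp add: B_def S_def)
  show "dual_optimal (inv_into {0<..} h) K u (L * R\<^sup>2 / (4 * A)) lam \<longleftrightarrow>
      lam = c1 powr (1 / c2) / (2 * c2)
        * (L * R\<^sup>2 / (4 * A)) powr (- (1 + 2 * c2) / (2 * c2))
        * (\<Sum>k<K. u k powr (1 / (1 + 2 * c2))) powr ((1 + 2 * c2) / (2 * c2))" for lam
    using dual_optimal_iff[of lam] by (simp only: B_def S_def)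
qed

end
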